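(* Let $N$ be a large positive integer and let $A, B \subseteq [N]^3$ be a partition of $[N]^3$ (i.e. $A \cap B = \emptyset$ and $A \cup B = [N]^3$). Then one of the six 2-dimensional projections $$ \pi_{XY}(A),\ \pi_{YZ}(A),\ \pi_{XZ}(A),\ \pi_{XY}(B),\ \pi_{YZ}(B),\ \pi_{XZ}(B)$$ has size (cardinality) at least $\frac{3}{4} N^2$.
   Context: $[N] = \{1,\dots,N\}$. The maps $\pi_{XY}, \pi_{YZ}, \pi_{XZ} : [N]^3 \to [N]^2$ are the coordinate projections $\pi_{XY}(x,y,z) = (x,y)$, $\pi_{YZ}(x,y,z) = (y,z)$, $\pi_{XZ}(x,y,z)=(x,z)$, and $\pi(A)$ denotes the image of the set $A$ under the map $\pi$. *)

theory Defs
  imports Complex_Main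
begin

definition grid :: "nat \<Rightarrow> (nat \<times> nat \<times> nat) set" where
  "grid N = {1..N} \<times> {1..N} \<times> {1..N}"

definition proj_XY :: "nat \<times> nat \<times> nat \<Rightarrow> nat \<times> nat" where
  "proj_XY = (\<lambda>(x, y, z). (x, y))"

definition proj_YZ :: "nat \<times> nat \<times> nat \<Rightarrow> nat \<times> nat" where
  "proj_YZ = (\<lambda>(x, y, z). (y, z))"

definition proj_XZ :: "nat \<times> nat \<times> nat \<Rightarrow> nat \<times> nat" where
  "proj_XZ = (\<lambda>(x, y, z). (x, z))"

end

theory Submission
  imports Defs
begin

text \<open>
  Call a line parallel to an axis \<^emph>\<open>full\<close> in a set if the set contains the whole line. The lines
  missed by a projection of \<open>A\<close> are the lines full in \<open>B\<close>, and conversely. A line full in \<open>B\<close> and a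
  line full in \<open>A\<close> with different directions never meet, so the two families occupy disjoint sets of
  values of the coordinate that they share; the numbers of these values add up to at most \<open>N\<close> and
  have product at most \<open>N\<^sup>2 / 4\<close>. The six families (two sets, three directions) form a 6-cycle under
  this relation, and each family is at most as large as the product of the sizes of its two
  coordinate sets. Hence the product of the six sizes is at most \<open>(N\<^sup>2 / 4)\<^sup>6\<close>, so one projection
  misses at most \<open>N\<^sup>2 / 4\<close> lines.
\<close>

text \<open>For a coordinate projection \<open>f\<close>, a pair in this set encodes an
  axis-parallel grid line disjoint from \<open>S\<close>. When two sets cover the grid, such a line
  is full in the other one.\<close>

definition missed :: "nat \<Rightarrow> ('a \<Rightarrow> nat \<times> nat) \<Rightarrow> 'a set \<Rightarrow> (nat \<times> nat) set" where
  "missed N f S = {1..N} \<times> {1..N} - f ` S"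

lemma finite_missed [simp]: "finite (missed N f S)"
  by (simp add: missed_def)

lemma card_missed:
  assumes "f ` S \<subseteq> {1..N} \<times> {1..N}"
  shows "real (card (missed N f S)) = (real N)\<^sup>2 - real (card (f ` S))"
proof -
  have fin: "finite (f ` S)"
    using assms by (rule finite_subset) simp
  have "card (f ` S) \<le> N * N"
    using card_mono[OF _ assms] by (simp add: card_cartesian_product)
  moreover have "card (missed N f S) = N * N - card (f ` S)"
    using card_Diff_subset[OF fin assms] by (simp add: missed_def card_cartesian_product)
  ultimately show ?thesis
    by (simp add: of_nat_diff power2_eq_square)
qed

lemma card_le_card_fst_mult_card_snd:
  assumes "finite R"
  shows "card R \<le> card (fst ` R) * card (snd ` R)"
proof -
  have "card R \<le> card (fst ` R \<times> snd ` R)"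
    using assms by (intro card_mono subset_fst_snd) auto
  then show ?thesis
    by (simp add: card_cartesian_product)
qed

lemma card_add_card_le_of_disjoint:
  assumes "S \<inter> T = {}" "S \<subseteq> {1..N}" "T \<subseteq> {1..N}"
  shows "card S + card T \<le> N"
proof -
  have "card S + card T = card (S \<union> T)"
    using assms by (metis card_Un_disjoint finite_atLeastAtMost finite_subset)
  also have "\<dots> \<le> card {1..N}"
    using assms by (intro card_mono) auto
  finally show ?thesis by simp
qed

text \<open>Two lines with different directions and the same value of their shared coordinate lie in
  one plane and meet. If one avoids \<open>A\<close> and the other avoids \<open>B\<close>, the
  meeting point violates the covering.\<close>

lemma missed_coordinates:
  assumes "grid N \<subseteq> A \<union> B"
  shows "card (fst ` missed N proj_XY A) + card (fst ` missed N proj_XZ B) \<le> N"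
    and "card (snd ` missed N proj_XZ B) + card (snd ` missed N proj_YZ A) \<le> N"
    and "card (fst ` missed N proj_YZ A) + card (snd ` missed N proj_XY B) \<le> N"
proof -
  have cover: "(x, y, z) \<in> A \<or> (x, y, z) \<in> B"
    if "x \<in> {1..N}" "y \<in> {1..N}" "z \<in> {1..N}" for x y z
    using assms that unfolding grid_def by blast
  have xy: "(x, y) \<in> proj_XY ` S" and yz: "(y, z) \<in> proj_YZ ` S" and xz: "(x, z) \<in> proj_XZ ` S"
    if "(x, y, z) \<in> S" for x y z S
    using that by (force simp: proj_XY_def proj_YZ_def proj_XZ_def)+
  show "card (fst ` missed N proj_XY A) + card (fst ` missed N proj_XZ B) \<le> N"
  proof (rule card_add_card_le_of_disjoint)
    show "fst ` missed N proj_XY A \<inter> fst ` missed N proj_XZ B = {}"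
    proof (rule equals0I)
      fix x assume "x \<in> fst ` missed N proj_XY A \<inter> fst ` missed N proj_XZ B"
      \<comment> \<open>The line avoiding \<open>A\<close> supplies \<open>y\<close>, the one
        avoiding \<open>B\<close> supplies \<open>z\<close>; they cross at
        \<open>(x, y, z)\<close>.\<close>
      then obtain y z where "x \<in> {1..N}" "y \<in> {1..N}" "z \<in> {1..N}" "(x, y) \<notin> proj_XY ` A" "(x, z) \<notin> proj_XZ ` B"
        unfolding missed_def by auto
      then show False
        using cover[of x y z] xy[of x y z A] xz[of x y z B] by blast
    qed
  qed (auto simp: missed_def)
  show "card (snd ` missed N proj_XZ B) + card (snd ` missed N proj_YZ A) \<le> N"
  proof (rule card_add_card_le_of_disjoint)
    show "snd ` missed N proj_XZ B \<inter> snd ` missed N proj_YZ A = {}"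
    proof (rule equals0I)
      fix z assume "z \<in> snd ` missed N proj_XZ B \<inter> snd ` missed N proj_YZ A"
      then obtain x y where "x \<in> {1..N}" "y \<in> {1..N}" "z \<in> {1..N}" "(x, z) \<notin> proj_XZ ` B" "(y, z) \<notin> proj_YZ ` A"
        unfolding missed_def by auto
      then show False
        using cover[of x y z] yz[of x y z A] xz[of x y z B] by blast
    qed
  qed (auto simp: missed_def)
  show "card (fst ` missed N proj_YZ A) + card (snd ` missed N proj_XY B) \<le> N"
  proof (rule card_add_card_le_of_disjoint)
    show "fst ` missed N proj_YZ A \<inter> snd ` missed N proj_XY B = {}"
    proof (rule equals0I)
      fix y assume "y \<in> fst ` missed N proj_YZ A \<inter> snd ` missed N proj_XY B"
      then obtain x z where "x \<in> {1..N}" "y \<in> {1..N}" "z \<in> {1..N}" "(y, z) \<notin> proj_YZ ` A" "(x, y) \<notin> proj_XY ` B"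
        unfolding missed_def by auto
      then show False
        using cover[of x y z] xy[of x y z B] yz[of x y z A] by blast
    qed
  qed (auto simp: missed_def)
qed

text \<open>As \<sigma> permutes \<open>I\<close>, re-pairing the factors leaves the total product
  unchanged, and AM-GM bounds each \<open>p i * q i\<close> by \<open>n\<^sup>2 / 4\<close>. So the
  re-paired products cannot all exceed that bound.\<close>

lemma cyclic_products_le:
  fixes p q :: "nat \<Rightarrow> real"
  assumes I: "finite I" "I \<noteq> {}" and \<sigma>: "bij_betw \<sigma> I I"
    and nonneg: "\<And>i. i \<in> I \<Longrightarrow> 0 \<le> p i" "\<And>i. i \<in> I \<Longrightarrow> 0 \<le> q i"
    and sum: "\<And>i. i \<in> I \<Longrightarrow> p i + q i \<le> n"
  shows "\<exists>i\<in>I. q i * p (\<sigma> i) \<le> n\<^sup>2 / 4"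
proof (rule ccontr)
  assume "\<not> ?thesis"
  then have big: "n\<^sup>2 / 4 < q i * p (\<sigma> i)" if "i \<in> I" for i
    using that by force
  have small: "p i * q i \<le> n\<^sup>2 / 4" if "i \<in> I" for i
  proof -
    have "4 * (p i * q i) \<le> (p i + q i)\<^sup>2"
      using zero_le_power2[of "p i - q i"] by (simp add: power2_eq_square algebra_simps)
    also have "\<dots> \<le> n\<^sup>2"
      using nonneg sum that by (intro power_mono) auto
    finally show ?thesis by simp
  qed
  \<comment> \<open>Strictness of the product inequality needs one strict factor, supplied by any
    \<open>j\<close> in the nonempty \<open>I\<close>.\<close>
  have "(\<Prod>i\<in>I. n\<^sup>2 / 4) < (\<Prod>i\<in>I. q i * p (\<sigma> i))"
  proof -
    obtain j where "j \<in> I" using I by blast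
    then show ?thesis
      using I big by (intro prod_mono_strict[of j]) (auto intro: less_imp_le le_less_trans[OF _ big])
  qed
  also have "\<dots> = (\<Prod>i\<in>I. q i) * (\<Prod>i\<in>I. p i)"
    using prod.reindex_bij_betw[OF \<sigma>, of p] by (simp add: prod.distrib)
  also have "\<dots> = (\<Prod>i\<in>I. p i * q i)"
    by (simp add: prod.distrib mult.commute)
  also have "\<dots> \<le> (\<Prod>i\<in>I. n\<^sup>2 / 4)"
    using nonneg small by (intro prod_mono) auto
  finally show False by simp
qed

theorem theorem6:
  "\<exists>N0::nat. \<forall>N\<ge>N0. N > 0 \<longrightarrow>
     (\<forall>A B. A \<inter> B = {} \<and> A \<union> B = grid N \<longrightarrow>
       (\<exists>S \<in> {proj_XY ` A, proj_YZ ` A, proj_XZ ` A, proj_XY ` B, proj_YZ ` B, proj_XZ ` B}.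
          real (card S) \<ge> 3 / 4 * (real N)\<^sup>2))"
proof (intro exI[of _ 0] allI impI)
  fix N :: nat and A B :: "(nat \<times> nat \<times> nat) set"
  assume "A \<inter> B = {} \<and> A \<union> B = grid N"
  then have AB: "A \<union> B = grid N" by blast
  \<comment> \<open>The lists go around the 6-cycle: \<open>p i\<close> and \<open>q i\<close> count
    values on the same axis for two adjacent families, while \<open>q i\<close> and
    \<open>p (\<sigma> i)\<close> belong to one family.\<close>
  define p q :: "nat \<Rightarrow> real" where
    "p = (!) (map (\<lambda>T. real (card T))
      [fst ` missed N proj_XY A, snd ` missed N proj_XZ B, fst ` missed N proj_YZ A,
       fst ` missed N proj_XY B, snd ` missed N proj_XZ A, fst ` missed N proj_YZ B])" and
    "q = (!) (map (\<lambda>T. real (card T))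
      [fst ` missed N proj_XZ B, snd ` missed N proj_YZ A, snd ` missed N proj_XY B,
       fst ` missed N proj_XZ A, snd ` missed N proj_YZ B, snd ` missed N proj_XY A])"
  define \<sigma> :: "nat \<Rightarrow> nat" where "\<sigma> i = (if i = 5 then 0 else i + 1)" for i
  define I :: "nat set" where "I = {0, 1, 2, 3, 4, 5}"
  \<comment> \<open>The first instance serves the indices 0 to 2, the exchanged one 3 to 5.\<close>
  note coords = missed_coordinates[of N A B] missed_coordinates[of N B A]
  have "\<exists>i\<in>I. q i * p (\<sigma> i) \<le> (real N)\<^sup>2 / 4"
  proof (rule cyclic_products_le)
    show "bij_betw \<sigma> I I"
      unfolding bij_betw_def inj_on_def I_def \<sigma>_def by auto
    show "p i + q i \<le> real N" if "i \<in> I" for i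
      using that coords AB unfolding I_def p_def q_def
      by (auto simp: Un_commute numeral_eq_Suc simp flip: of_nat_add)
  qed (auto simp: I_def p_def q_def numeral_eq_Suc)
  \<comment> \<open>Each index names one family; whether \<open>fst\<close> or \<open>snd\<close>
    comes first varies along the cycle.\<close>
  then have "\<exists>f S. (f, S) \<in> {proj_XY, proj_YZ, proj_XZ} \<times> {A, B} \<and>
      real (card (fst ` missed N f S)) * real (card (snd ` missed N f S)) \<le> (real N)\<^sup>2 / 4"
    unfolding I_def p_def q_def \<sigma>_def
    by (auto simp: numeral_eq_Suc mult.commute)
  then obtain f S where fS: "f \<in> {proj_XY, proj_YZ, proj_XZ}" "S \<in> {A, B}"
    and le: "real (card (fst ` missed N f S)) * real (card (snd ` missed N f S)) \<le> (real N)\<^sup>2 / 4"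
    by blast
  have "real (card (missed N f S)) \<le> (real N)\<^sup>2 / 4"
    using card_le_card_fst_mult_card_snd[of "missed N f S"] le
    by (simp flip: of_nat_mult)
  moreover have "f ` S \<subseteq> {1..N} \<times> {1..N}"
  proof -
    have "S \<subseteq> grid N" using fS AB by blast
    then show ?thesis
      using fS(1) unfolding grid_def proj_XY_def proj_YZ_def proj_XZ_def by fastforce
  qed
  ultimately have "3 / 4 * (real N)\<^sup>2 \<le> real (card (f ` S))"
    by (simp add: card_missed)
  then show "\<exists>S\<in>{proj_XY ` A, proj_YZ ` A, proj_XZ ` A, proj_XY ` B, proj_YZ ` B, proj_XZ ` B}.
      3 / 4 * (real N)\<^sup>2 \<le> real (card S)"
    using fS by blast
qed

end
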